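(* Let $(H_i,\vec\phi_i)$, $i=1,\dots,m$, be $\mu$-modules on pairwise disjoint vertex sets, $H_i=(V_i,E_i)$, $V_i=V_i^o\sqcup V_i^s$ (core and socket), with certificates $z^{(i)}_{vw}$. Assume: (1) for each $i$ there is $u_i\in V_i^s$ with $(\vec\phi_i)_{u_i}=0$; (2) there are a set $E'$ of edges on the vertex set $V'=\{u_1,\dots,u_m\}$ and numbers $\alpha_{ij}\in[-1,1]$, for $u_iu_j\in E'$, such that $\alpha_{ij}=-\alpha_{ji}$ and $$\sum_{v\in V_i,\,v\sim u_i}z^{(i)}_{u_iv}+\sum_{j:\,u_iu_j\in E'}\alpha_{ij}\in\mu\,(d_{u_i}+d'_{u_i})[-1,1]\qquad\text{for all } i,$$ where $d_{u_i}$ is the degree of $u_i$ in $H_i$ and $d'_{u_i}$ its degree in $(V',E')$. Let $V=\bigcup_iV_i$, $E=\bigcup_iE_i\cup E'$, $H=(V,E)$, assume $H$ is connected, and let $\vec\phi=\oplus_{i=1}^m\vec\phi_i\in\mathbb R^V$. Then, up to normalizing $\vec\phi$ to satisfy $\sum_v d_v|\phi_v|=1$, $(H,\vec\phi)$ is a $\mu$-module with core $V^o=\bigcup_iV_i^o\cup V'$ and socket $V^s=\bigcup_i(V_i^s\setminus\{u_i\})$.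
   Context: All graphs are finite, simple and undirected; $d_v$ is the degree of a vertex (in the graph under consideration). $\mathrm{Sgn}(t)=\{1\}$ if $t>0$, $\{-1\}$ if $t<0$, $[-1,1]$ if $t=0$. A $\mu$-module is a pair $(H,\vec\phi)$ where $H=(V_H,E_H)$ is a connected graph, $\vec\phi\in\mathbb R^{V_H}$ with $\sum_{v}d_v|\phi_v|=1$, $V_H=V_H^o\sqcup V_H^s$ (core and socket; the socket may be empty), no two vertices of $V_H^s$ are adjacent, and there exist numbers $z_{vw}\in\mathrm{Sgn}(\phi_v-\phi_w)$, $z_{wv}=-z_{vw}$ (for adjacent $v,w$) with $\sum_{w\sim v}z_{vw}\in\mu d_v\,\mathrm{Sgn}(\phi_v)$ for all $v\in V_H^o$ (degrees in $H$). Such a family $z$ is called here a certificate of the module. *)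

theory Defs
  imports Complex_Main "HOL-Library.Disjoint_Sets" "Graph_Theory.Digraph_Component"
begin

text \<open>
  A finite simple undirected graph is a \<^locale>\<open>pair_graph\<close>: a finite vertex set together with a
  finite, symmetric, loop-free set of ordered pairs. An undirected edge \<open>vw\<close> is the pair of arcs
  \<open>(v, w)\<close>, \<open>(w, v)\<close>, so the degree of a vertex is its out-degree.
\<close>

abbreviation deg :: "'a pair_pre_digraph \<Rightarrow> 'a \<Rightarrow> nat" where
  "deg G v \<equiv> out_degree (with_proj G) v"

definition Sgn :: "real \<Rightarrow> real set" where
  "Sgn t = (if t > 0 then {1} else if t < 0 then {-1} else {-1..1})"

text \<open>Vectors indexed by the vertices are total functions; only their values on the vertex set
  are ever used.\<close>

definition weighted_norm :: "'a pair_pre_digraph \<Rightarrow> ('a \<Rightarrow> real) \<Rightarrow> real" where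
  "weighted_norm G \<phi> = (\<Sum>v\<in>pverts G. real (deg G v) * \<bar>\<phi> v\<bar>)"

definition certificate ::
  "real \<Rightarrow> 'a pair_pre_digraph \<Rightarrow> ('a \<Rightarrow> real) \<Rightarrow> 'a set \<Rightarrow> ('a \<Rightarrow> 'a \<Rightarrow> real) \<Rightarrow> bool" where
  "certificate \<mu> G \<phi> Vo z \<longleftrightarrow>
     (\<forall>(v, w) \<in> parcs G. z v w \<in> Sgn (\<phi> v - \<phi> w) \<and> z w v = - z v w) \<and>
     (\<forall>v\<in>Vo. (\<Sum>w | (v, w) \<in> parcs G. z v w) \<in> (*) (\<mu> * real (deg G v)) ` Sgn (\<phi> v))"

text \<open>Note that \<^const>\<open>Digraph_Component.connected\<close> excludes the graph without vertices.\<close>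

definition mu_module ::
  "real \<Rightarrow> 'a pair_pre_digraph \<Rightarrow> ('a \<Rightarrow> real) \<Rightarrow> 'a set \<Rightarrow> 'a set \<Rightarrow> bool" where
  "mu_module \<mu> G \<phi> Vo Vs \<longleftrightarrow>
     pair_graph G \<and> Digraph_Component.connected (with_proj G) \<and>
     weighted_norm G \<phi> = 1 \<and>
     Vo \<union> Vs = pverts G \<and> Vo \<inter> Vs = {} \<and>
     (\<forall>v\<in>Vs. \<forall>w\<in>Vs. (v, w) \<notin> parcs G) \<and>
     (\<exists>z. certificate \<mu> G \<phi> Vo z)"

text \<open>For pairwise disjoint vertex sets \<open>V i\<close> at most one summand is nonzero.\<close>

definition direct_sum :: "'i set \<Rightarrow> ('i \<Rightarrow> 'a set) \<Rightarrow> ('i \<Rightarrow> 'a \<Rightarrow> real) \<Rightarrow> 'a \<Rightarrow> real" where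
  "direct_sum I V \<phi> v = (\<Sum>i\<in>I. if v \<in> V i then \<phi> i v else 0)"

end

theory Submission
  imports Defs
begin

text \<open>
  Every arc of \<open>G\<close> lies either in exactly one \<open>H i\<close> or in \<open>E'\<close>, so the certificates \<open>z i\<close> and the
  numbers \<open>\<alpha>\<close> glue to a function on the arcs of \<open>G\<close>. At an old core vertex neither the degree nor
  the sum changes; at \<open>u i\<close>, where \<open>\<psi>\<close> vanishes, the core condition is the balance hypothesis; and
  \<open>\<alpha> i j \<in> {-1..1} = Sgn (\<psi> (u i) - \<psi> (u j))\<close>. Degrees only grow, so \<open>\<psi>\<close> has norm at least 1 and
  can be normalized, which leaves all signs unchanged.
\<close>

text \<open>Turns the locale into set conditions that pass easily to unions of graphs. Finiteness of
  the arc set is recovered from that of the vertex set.\<close>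

lemma pair_graph_iff:
  "pair_graph G \<longleftrightarrow>
     finite (pverts G) \<and> parcs G \<subseteq> pverts G \<times> pverts G \<and> sym (parcs G) \<and> irrefl (parcs G)"
proof
  assume "pair_graph G"
  then interpret pair_graph G .
  show "finite (pverts G) \<and> parcs G \<subseteq> pverts G \<times> pverts G \<and> sym (parcs G) \<and> irrefl (parcs G)"
    using pair_finite_verts arc_fst_in_verts arc_snd_in_verts pair_sym_arcs pair_no_loops
    by (fastforce simp: symmetric_def irrefl_def)
next
  assume *: "finite (pverts G) \<and> parcs G \<subseteq> pverts G \<times> pverts G \<and> sym (parcs G) \<and> irrefl (parcs G)"
  then have "finite (parcs G)"
    by (meson finite_SigmaI finite_subset)
  with * show "pair_graph G"
    by unfold_locales (auto simp: symmetric_def irrefl_def)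
qed

lemma deg_eq_card: "deg G v = card {w. (v, w) \<in> parcs G}"
proof -
  have "out_arcs (with_proj G) v = Pair v ` {w. (v, w) \<in> parcs G}"
    by (auto simp: out_arcs_def)
  then show ?thesis
    by (simp add: out_degree_def card_image inj_on_def)
qed

lemma finite_neighbours:
  assumes "pair_graph G"
  shows "finite {w. (v, w) \<in> parcs G}"
  by (rule finite_subset[of _ "pverts G"]) (use assms in \<open>auto simp: pair_graph_iff\<close>)

lemma Sgn_divide: "c > 0 \<Longrightarrow> Sgn (t / c) = Sgn t"
  by (simp add: Sgn_def zero_less_divide_iff divide_less_0_iff)

text \<open>A certificate sees \<open>\<phi>\<close> only through the signs of its values and
  differences, which positive rescaling preserves.\<close>

lemma certificate_scale:
  "c > 0 \<Longrightarrow> certificate \<mu> G (\<lambda>v. \<phi> v / c) Vo z \<longleftrightarrow> certificate \<mu> G \<phi> Vo z"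
  by (simp add: certificate_def Sgn_divide flip: diff_divide_distrib)

lemma weighted_norm_scale:
  "c > 0 \<Longrightarrow> weighted_norm G (\<lambda>v. \<phi> v / c) = weighted_norm G \<phi> / c"
  by (simp add: weighted_norm_def sum_divide_distrib)

text \<open>A larger graph has larger degrees and only adds nonnegative terms. This bounds the norm
  of the glued vector from below by that of a single module.\<close>

lemma weighted_norm_mono:
  assumes "pair_graph G" "pverts H \<subseteq> pverts G" "parcs H \<subseteq> parcs G"
    and "\<And>v. v \<in> pverts H \<Longrightarrow> \<bar>\<phi> v\<bar> \<le> \<bar>\<psi> v\<bar>"
  shows "weighted_norm H \<phi> \<le> weighted_norm G \<psi>"
proof -
  have "deg H v \<le> deg G v" for v
    unfolding deg_eq_card
    by (rule card_mono) (use assms finite_neighbours in auto)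
  then have "weighted_norm H \<phi> \<le> (\<Sum>v\<in>pverts H. real (deg G v) * \<bar>\<psi> v\<bar>)"
    unfolding weighted_norm_def by (intro sum_mono mult_mono) (use assms(4) in auto)
  also have "\<dots> \<le> weighted_norm G \<psi>"
    unfolding weighted_norm_def
    by (rule sum_mono2) (use assms(1,2) in \<open>auto simp: pair_graph_iff\<close>)
  finally show ?thesis .
qed

lemma direct_sum_eq:
  assumes "finite I" "disjoint_family_on V I" "i \<in> I" "v \<in> V i"
  shows "direct_sum I V \<phi> v = \<phi> i v"
proof -
  have "(\<Sum>j\<in>I. if v \<in> V j then \<phi> j v else 0) = (\<Sum>j\<in>I. if j = i then \<phi> j v else 0)"
    by (rule sum.cong) (use assms in \<open>auto simp: disjoint_family_on_def\<close>)
  then show ?thesis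
    using assms by (simp add: direct_sum_def)
qed

text \<open>The graph conditions do not involve \<open>\<phi>\<close> and a certificate survives
  rescaling, so the construction can work with the raw vector and divide at the very end.\<close>

lemma mu_module_normalize:
  assumes "pair_graph G" "Digraph_Component.connected (with_proj G)" "weighted_norm G \<phi> > 0"
    and "Vo \<union> Vs = pverts G" "Vo \<inter> Vs = {}" "\<And>v w. v \<in> Vs \<Longrightarrow> w \<in> Vs \<Longrightarrow> (v, w) \<notin> parcs G"
    and "certificate \<mu> G \<phi> Vo z"
  shows "mu_module \<mu> G (\<lambda>v. \<phi> v / weighted_norm G \<phi>) Vo Vs"
  using assms by (auto simp: mu_module_def certificate_scale weighted_norm_scale)

text \<open>The gluing uses no order on the indices, so it is carried out over an arbitrary finite
  index set.\<close>

lemma mu_module_glue: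
  fixes \<mu> :: real and I :: "'i set"
    and H :: "'i \<Rightarrow> 'a pair_pre_digraph" and \<phi> :: "'i \<Rightarrow> 'a \<Rightarrow> real"
    and Vo Vs :: "'i \<Rightarrow> 'a set"
    and z :: "'i \<Rightarrow> 'a \<Rightarrow> 'a \<Rightarrow> real"
    and u :: "'i \<Rightarrow> 'a" and V' :: "'a set" and E' :: "('a \<times> 'a) set"
    and \<alpha> :: "'i \<Rightarrow> 'i \<Rightarrow> real"
    and G :: "'a pair_pre_digraph" and \<psi> :: "'a \<Rightarrow> real"
  assumes fin: "finite I"
    and modules: "\<And>i. i \<in> I \<Longrightarrow> mu_module \<mu> (H i) (\<phi> i) (Vo i) (Vs i)"
    and certificates: "\<And>i. i \<in> I \<Longrightarrow> certificate \<mu> (H i) (\<phi> i) (Vo i) (z i)"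
    and disjoint: "disjoint_family_on (\<lambda>i. pverts (H i)) I"
    and u: "\<And>i. i \<in> I \<Longrightarrow> u i \<in> Vs i \<and> \<phi> i (u i) = 0"
    and V': "V' = u ` I"
    and E': "pair_graph \<lparr>pverts = V', parcs = E'\<rparr>"
    and \<alpha>: "\<And>i j. i \<in> I \<Longrightarrow> j \<in> I \<Longrightarrow> (u i, u j) \<in> E' \<Longrightarrow>
              \<alpha> i j \<in> {-1..1} \<and> \<alpha> i j = - \<alpha> j i"
    and balance: "\<And>i. i \<in> I \<Longrightarrow>
              (\<Sum>v | (u i, v) \<in> parcs (H i). z i (u i) v)
                + (\<Sum>j | j \<in> I \<and> (u i, u j) \<in> E'. \<alpha> i j)
              \<in> (*) (\<mu> * real (deg (H i) (u i) + deg \<lparr>pverts = V', parcs = E'\<rparr> (u i))) ` {-1..1}"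
    and G: "G = \<lparr>pverts = (\<Union>i\<in>I. pverts (H i)),
                 parcs = (\<Union>i\<in>I. parcs (H i)) \<union> E'\<rparr>"
    and connected: "Digraph_Component.connected (with_proj G)"
    and \<psi>: "\<psi> = direct_sum I (\<lambda>i. pverts (H i)) \<phi>"
  shows "mu_module \<mu> G (\<lambda>v. \<psi> v / weighted_norm G \<psi>)
           ((\<Union>i\<in>I. Vo i) \<union> V') (\<Union>i\<in>I. Vs i - {u i})"
proof -

  \<comment> \<open>Incidences between the modules and the connecting edges\<close>
  have H: "pair_graph (H i)" "Vo i \<union> Vs i = pverts (H i)" "Vo i \<inter> Vs i = {}"
    "weighted_norm (H i) (\<phi> i) = 1" "\<And>v w. v \<in> Vs i \<Longrightarrow> w \<in> Vs i \<Longrightarrow> (v, w) \<notin> parcs (H i)"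
    if "i \<in> I" for i
    using modules[OF that] by (auto simp: mu_module_def)
  have uV: "u i \<in> pverts (H i)" if "i \<in> I" for i
    using u[OF that] H(2)[OF that] by auto
  have same: "i = j" if "i \<in> I" "j \<in> I" "v \<in> pverts (H i)" "v \<in> pverts (H j)" for i j v
    using disjoint that unfolding disjoint_family_on_def by blast
  have arcsH: "v \<in> pverts (H i)" "w \<in> pverts (H i)" "(w, v) \<in> parcs (H i)"
    if "i \<in> I" "(v, w) \<in> parcs (H i)" for i v w
    using H(1)[OF that(1)] that(2) by (auto simp: pair_graph_iff dest: symD)
  \<comment> \<open>Since \<open>E'\<close> lives on \<open>V'\<close> and has no loops, its arcs
    join distinct modules.\<close>
  have arcsE': "\<exists>i\<in>I. \<exists>j\<in>I. i \<noteq> j \<and> v = u i \<and> w = u j" if "(v, w) \<in> E'" for v w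
  proof -
    have "v \<in> u ` I" "w \<in> u ` I" "v \<noteq> w"
      using E' that by (auto simp: pair_graph_iff V' irrefl_def)
    then obtain i j where "i \<in> I" "v = u i" "j \<in> I" "w = u j" "u i \<noteq> u j"
      by (elim imageE) simp
    moreover from this have "i \<noteq> j" by metis
    ultimately show ?thesis by metis
  qed
  have symE': "(w, v) \<in> E'" if "(v, w) \<in> E'" for v w
    using E' that by (auto simp: pair_graph_iff dest: symD)
  \<comment> \<open>Each \<open>H i\<close> contains only one point of \<open>V'\<close>, namely
    \<open>u i\<close>, so an arc of \<open>E'\<close> inside it would be a loop.\<close>
  have notE': "(v, w) \<notin> E'" if "i \<in> I" "v \<in> pverts (H i)" "w \<in> pverts (H i)" for i v w
  proof
    assume "(v, w) \<in> E'"
    then obtain j k where jk: "j \<in> I" "k \<in> I" "j \<noteq> k" "v = u j" "w = u k"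
      using arcsE' by blast
    then have "j = i" "k = i"
      using same uV that by blast+
    with jk show False by simp
  qed
  have V'_iff: "v \<in> V' \<longleftrightarrow> v = u i" if "i \<in> I" "v \<in> pverts (H i)" for i v
  proof
    assume "v \<in> V'"
    then obtain j where "j \<in> I" "v = u j"
      unfolding V' by blast
    then show "v = u i"
      using same that uV by blast
  qed (use that V' in blast)

  \<comment> \<open>The glued graph is finite and simple\<close>
  have vertsG: "v \<in> pverts G" if "i \<in> I" "v \<in> pverts (H i)" for i v
    unfolding G using that by auto
  have graphG: "pair_graph G"
    unfolding pair_graph_iff
  proof (intro conjI)
    show "finite (pverts G)"
      using fin H(1) by (simp add: G pair_graph_iff)
    show "parcs G \<subseteq> pverts G \<times> pverts G"
    proof clarify
      fix v w assume "(v, w) \<in> parcs G"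
      then consider i where "i \<in> I" "(v, w) \<in> parcs (H i)" | "(v, w) \<in> E'"
        by (auto simp: G)
      then show "v \<in> pverts G \<and> w \<in> pverts G"
      proof cases
        case 1
        then show ?thesis
          using arcsH(1,2)[OF 1] vertsG by metis
      next
        case 2
        then obtain i j where "i \<in> I" "j \<in> I" "v = u i" "w = u j"
          using arcsE' by blast
        then show ?thesis
          using uV vertsG by metis
      qed
    qed
    show "sym (parcs G)"
    proof (rule symI)
      fix v w assume "(v, w) \<in> parcs G"
      then consider i where "i \<in> I" "(v, w) \<in> parcs (H i)" | "(v, w) \<in> E'"
        by (auto simp: G)
      then show "(w, v) \<in> parcs G"
        by cases (use arcsH(3) symE' in \<open>auto simp: G\<close>)
    qed
    show "irrefl (parcs G)"
      using H(1) E' by (auto simp: G pair_graph_iff irrefl_def)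
  qed

  \<comment> \<open>The glued vector and positivity of its norm\<close>
  have \<psi>_eq: "\<psi> v = \<phi> i v" if "i \<in> I" "v \<in> pverts (H i)" for i v
    unfolding \<psi> by (rule direct_sum_eq[OF fin disjoint that])
  have \<psi>_u: "\<psi> (u i) = 0" if "i \<in> I" for i
    using \<psi>_eq[OF that uV[OF that]] u[OF that] by simp

  \<comment> \<open>A connected graph has a vertex, so some module exists whose norm 1 bounds that
    of \<open>\<psi>\<close> from below.\<close>
  have "I \<noteq> {}"
    using connected unfolding G connected_def strongly_connected_def by force
  then obtain i0 where i0: "i0 \<in> I" by blast
  have "weighted_norm (H i0) (\<phi> i0) \<le> weighted_norm G \<psi>"
    by (rule weighted_norm_mono[OF graphG]) (use i0 \<psi>_eq in \<open>auto simp: G\<close>)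
  then have norm_pos: "weighted_norm G \<psi> > 0"
    using H(4)[OF i0] by simp

  \<comment> \<open>The glued certificate\<close>
  define \<iota> where "\<iota> v = (THE i. i \<in> I \<and> v \<in> pverts (H i))" for v
  have \<iota>_eq: "\<iota> v = i" if "i \<in> I" "v \<in> pverts (H i)" for i v
    unfolding \<iota>_def by (rule the_equality) (use that in \<open>auto intro: same\<close>)
  \<comment> \<open>\<open>\<iota> v\<close> is the one module containing \<open>v\<close>. By
    \<open>notE'\<close> no arc of a module lies in \<open>E'\<close>, so the two cases never
    compete. On a module arc both ends have the same index, so that of the tail can be used.\<close>
  define \<zeta> where "\<zeta> v w = (if (v, w) \<in> E' then \<alpha> (\<iota> v) (\<iota> w) else z (\<iota> v) v w)" for v w
  have \<zeta>_H: "\<zeta> v w = z i v w" if "i \<in> I" "(v, w) \<in> parcs (H i)" for i v w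
    using arcsH[OF that] notE'[OF that(1)] \<iota>_eq[OF that(1)] by (simp add: \<zeta>_def)
  have \<zeta>_E': "\<zeta> (u i) (u j) = \<alpha> i j" if "i \<in> I" "j \<in> I" "(u i, u j) \<in> E'" for i j
    using that \<iota>_eq[OF _ uV] by (simp add: \<zeta>_def)
  \<comment> \<open>Allows the sum of \<open>\<zeta>\<close> over the \<open>E'\<close>-neighbours
    of \<open>u i\<close> to be reindexed as the sum over indices \<open>j\<close> in
    \<open>balance\<close>.\<close>
  have inj_u: "inj_on u I"
  proof (rule inj_onI)
    fix i j assume "i \<in> I" "j \<in> I" "u i = u j"
    then show "i = j"
      using same[of i j "u i"] uV[of i] uV[of j] by simp
  qed

  have cert: "certificate \<mu> G \<psi> ((\<Union>i\<in>I. Vo i) \<union> V') \<zeta>"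
    unfolding certificate_def
  proof (intro conjI ballI, clarify)
    fix v w assume "(v, w) \<in> parcs G"
    then consider i where "i \<in> I" "(v, w) \<in> parcs (H i)" | "(v, w) \<in> E'"
      by (auto simp: G)
    then show "\<zeta> v w \<in> Sgn (\<psi> v - \<psi> w) \<and> \<zeta> w v = - \<zeta> v w"
    proof cases
      case 1
      note arc = arcsH[OF 1]
      have "z i v w \<in> Sgn (\<phi> i v - \<phi> i w) \<and> z i w v = - z i v w"
        using certificates[OF 1(1)] 1(2) by (auto simp: certificate_def)
      then show ?thesis
        using 1 arc by (simp add: \<zeta>_H \<psi>_eq)
    next
      case 2
      then obtain i j where ij: "i \<in> I" "j \<in> I" "v = u i" "w = u j"
        using arcsE' by blast
      then show ?thesis
        using 2 \<alpha>[of i j] symE'[OF 2] by (simp add: \<zeta>_E' \<psi>_u Sgn_def)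
    qed
  next
    fix v assume v: "v \<in> (\<Union>i\<in>I. Vo i) \<union> V'"
    then obtain i where i: "i \<in> I" and vcases: "v \<in> Vo i \<or> v = u i"
      by (auto simp: V')
    then have vH: "v \<in> pverts (H i)"
      using H(2)[OF i] uV by auto
    let ?N = "{w. (v, w) \<in> parcs (H i)}" and ?N' = "{w. (v, w) \<in> E'}"
    \<comment> \<open>Only the arcs of \<open>E'\<close> can be new at \<open>v\<close>, because
      \<open>v\<close> lies in no other module.\<close>
    have "j = i" if "j \<in> I" "(v, w) \<in> parcs (H j)" for j w
      using same[OF that(1) i arcsH(1)[OF that] vH] .
    then have N: "{w. (v, w) \<in> parcs G} = ?N \<union> ?N'"
      using i by (auto simp: G)
    \<comment> \<open>No neighbour is counted twice, so both the degree and the certificate sum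
      split into a module part and an \<open>E'\<close> part.\<close>
    have disj: "?N \<inter> ?N' = {}"
      using notE'[OF i vH] arcsH(2)[OF i] by auto
    have finN: "finite ?N" "finite ?N'"
      using finite_neighbours[OF H(1)[OF i]] finite_neighbours[OF E'] by auto
    have degG: "deg G v = deg (H i) v + deg \<lparr>pverts = V', parcs = E'\<rparr> v"
      unfolding deg_eq_card N using card_Un_disjoint[OF finN disj] by simp
    have "(\<Sum>w | (v, w) \<in> parcs G. \<zeta> v w) = (\<Sum>w\<in>?N. \<zeta> v w) + (\<Sum>w\<in>?N'. \<zeta> v w)"
      unfolding N by (rule sum.union_disjoint[OF finN disj])
    also have "(\<Sum>w\<in>?N. \<zeta> v w) = (\<Sum>w\<in>?N. z i v w)"
      using i by (simp add: \<zeta>_H)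
    finally have sumG: "(\<Sum>w | (v, w) \<in> parcs G. \<zeta> v w) = (\<Sum>w\<in>?N. z i v w) + (\<Sum>w\<in>?N'. \<zeta> v w)" .
    show "(\<Sum>w | (v, w) \<in> parcs G. \<zeta> v w) \<in> (*) (\<mu> * real (deg G v)) ` Sgn (\<psi> v)"
    proof (cases "v = u i")
      case True
      let ?J = "{j. j \<in> I \<and> (u i, u j) \<in> E'}"
      have "?N' = u ` ?J"
        using True arcsE' by fastforce
      then have "(\<Sum>w\<in>?N'. \<zeta> v w) = (\<Sum>j\<in>?J. \<zeta> (u i) (u j))"
        using True sum.reindex[OF inj_on_subset[OF inj_u], of ?J] by auto
      also have "\<dots> = (\<Sum>j\<in>?J. \<alpha> i j)"
        by (rule sum.cong) (use i \<zeta>_E' in auto)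
      finally show ?thesis
        unfolding sumG degG using balance[OF i] True \<psi>_u[OF i] by (simp add: Sgn_def)
    next
      case False
      \<comment> \<open>\<open>V'\<close> meets \<open>H i\<close> only in \<open>u i\<close>, and
        every arc of \<open>E'\<close> starts in \<open>V'\<close>.\<close>
      then have "v \<in> Vo i" "?N' = {}"
        using vcases arcsE' V'_iff[OF i vH] by (auto simp: V')
      then show ?thesis
        unfolding sumG degG using certificates[OF i] \<psi>_eq[OF i vH]
        \<comment> \<open>The degree is expanded only for the graph of \<open>E'\<close>, where it
          becomes the cardinality of the empty set. The degree in \<open>H i\<close> keeps the form
          it has in the certificate.\<close>
        by (simp add: deg_eq_card[of "\<lparr>pverts = V', parcs = E'\<rparr>"] certificate_def)
    qed
  qed

  \<comment> \<open>Core and socket of the glued graph\<close>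
  show ?thesis
  proof (rule mu_module_normalize[OF graphG connected norm_pos _ _ _ cert])
    show "(\<Union>i\<in>I. Vo i) \<union> V' \<union> (\<Union>i\<in>I. Vs i - {u i}) = pverts G"
    proof -
      have "Vo i \<union> Vs i \<union> {u i} = pverts (H i)" if "i \<in> I" for i
        using H(2)[OF that] uV[OF that] by blast
      then have "pverts G = (\<Union>i\<in>I. Vo i \<union> Vs i \<union> {u i})"
        by (simp add: G)
      then show ?thesis
        by (auto simp: V')
    qed
    show "((\<Union>i\<in>I. Vo i) \<union> V') \<inter> (\<Union>i\<in>I. Vs i - {u i}) = {}"
    proof (rule equals0I)
      fix v assume "v \<in> ((\<Union>i\<in>I. Vo i) \<union> V') \<inter> (\<Union>i\<in>I. Vs i - {u i})"
      then have v: "v \<in> (\<Union>i\<in>I. Vo i) \<union> V'" "v \<in> (\<Union>i\<in>I. Vs i - {u i})"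
        by simp_all
      obtain i where i: "i \<in> I" "v \<in> Vo i \<or> v = u i"
        using v(1) by (auto simp: V')
      obtain j where j: "j \<in> I" "v \<in> Vs j - {u j}"
        using v(2) by auto
      have "v \<in> pverts (H i)" "v \<in> pverts (H j)"
        using H(2)[OF i(1)] H(2)[OF j(1)] uV[OF i(1)] i(2) j(2) by auto
      \<comment> \<open>A clash is possible only within one module, where the old core misses the
        socket and \<open>u i\<close> has been removed from it.\<close>
      then have "i = j"
        by (rule same[OF i(1) j(1)])
      then show False
        using i(2) j(2) H(3)[OF i(1)] by auto
    qed
    show "(v, w) \<notin> parcs G"
      if v: "v \<in> (\<Union>i\<in>I. Vs i - {u i})" and w: "w \<in> (\<Union>i\<in>I. Vs i - {u i})" for v w
    proof
      assume arc: "(v, w) \<in> parcs G"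
      obtain i j where i: "i \<in> I" "v \<in> Vs i" "v \<noteq> u i" and j: "j \<in> I" "w \<in> Vs j"
        using v w by blast
      have vi: "v \<in> pverts (H i)" and wj: "w \<in> pverts (H j)"
        using i j H(2) by blast+
      \<comment> \<open>A remaining socket vertex is not in \<open>V'\<close>, so an arc between two
        of them would come from a single module and join two of its old socket vertices.\<close>
      have "v \<notin> V'"
        using V'_iff vi i by blast
      then have "(v, w) \<notin> E'"
        using arcsE' by (auto simp: V')
      then obtain k where k: "k \<in> I" "(v, w) \<in> parcs (H k)"
        using arc by (auto simp: G)
      then have "k = i" "k = j"
        using same[OF k(1) i(1) arcsH(1)[OF k] vi] same[OF k(1) j(1) arcsH(2)[OF k] wj] by auto
      then show False
        using H(5)[OF k(1)] i(2) j(2) k(2) by auto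
    qed
  qed
qed

text \<open>Normalization is rendered as division by the norm of \<open>\<psi>\<close> taken with
  the degrees of \<open>G\<close>. The case \<open>m = 0\<close> is excluded by
  \<open>connected\<close>, since the graph without vertices is not connected.\<close>

theorem proposition5:
  fixes \<mu> :: real and m :: nat
    and H :: "nat \<Rightarrow> 'a pair_pre_digraph" and \<phi> :: "nat \<Rightarrow> 'a \<Rightarrow> real"
    and Vo Vs :: "nat \<Rightarrow> 'a set"
    and z :: "nat \<Rightarrow> 'a \<Rightarrow> 'a \<Rightarrow> real"
    and u :: "nat \<Rightarrow> 'a" and V' :: "'a set" and E' :: "('a \<times> 'a) set"
    and \<alpha> :: "nat \<Rightarrow> nat \<Rightarrow> real"
    and G :: "'a pair_pre_digraph" and \<psi> :: "'a \<Rightarrow> real"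
  assumes modules: "\<And>i. i \<in> {1..m} \<Longrightarrow> mu_module \<mu> (H i) (\<phi> i) (Vo i) (Vs i)"
    and certificates: "\<And>i. i \<in> {1..m} \<Longrightarrow> certificate \<mu> (H i) (\<phi> i) (Vo i) (z i)"
    and disjoint: "disjoint_family_on (\<lambda>i. pverts (H i)) {1..m}"
    and u: "\<And>i. i \<in> {1..m} \<Longrightarrow> u i \<in> Vs i \<and> \<phi> i (u i) = 0"
    and V': "V' = u ` {1..m}"
    and E': "pair_graph \<lparr>pverts = V', parcs = E'\<rparr>"
    and \<alpha>: "\<And>i j. i \<in> {1..m} \<Longrightarrow> j \<in> {1..m} \<Longrightarrow> (u i, u j) \<in> E' \<Longrightarrow>
              \<alpha> i j \<in> {-1..1} \<and> \<alpha> i j = - \<alpha> j i"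
    and balance: "\<And>i. i \<in> {1..m} \<Longrightarrow>
              (\<Sum>v | (u i, v) \<in> parcs (H i). z i (u i) v)
                + (\<Sum>j | j \<in> {1..m} \<and> (u i, u j) \<in> E'. \<alpha> i j)
              \<in> (*) (\<mu> * real (deg (H i) (u i) + deg \<lparr>pverts = V', parcs = E'\<rparr> (u i))) ` {-1..1}"
    and G: "G = \<lparr>pverts = (\<Union>i\<in>{1..m}. pverts (H i)),
                 parcs = (\<Union>i\<in>{1..m}. parcs (H i)) \<union> E'\<rparr>"
    and connected: "Digraph_Component.connected (with_proj G)"
    and \<psi>: "\<psi> = direct_sum {1..m} (\<lambda>i. pverts (H i)) \<phi>"
  shows "mu_module \<mu> G (\<lambda>v. \<psi> v / weighted_norm G \<psi>)
           ((\<Union>i\<in>{1..m}. Vo i) \<union> V') (\<Union>i\<in>{1..m}. Vs i - {u i})"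
  by (rule mu_module_glue[OF _ modules certificates disjoint u V' E' \<alpha> balance G connected \<psi>]) simp_all

end
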